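(* If $G$ is a diamond-free graph with $\chi(K(G))=\omega(K(G))$, then $T(G)=\chi(K(G))$.
   Context: A graph is diamond-free if it has no induced subgraph isomorphic to $K_4$ minus an edge. $K(G)$ is the clique graph of $G$ (intersection graph of the maximal cliques of $G$); $\chi$ is the chromatic number and $\omega$ the size of a maximum clique. A tessellation of $G$ is a partition of $V(G)$ into cliques; an edge belongs to it iff its endpoints lie in the same clique of the partition. A tessellation cover of $G$ is a set of tessellations such that every edge of $G$ belongs to at least one of them. $T(G)$, the tessellation cover number, is the minimum size of a tessellation cover of $G$.
   Formalization: The graph G is additionally assumed to have at least one edge: for a graph with vertices but no edges, the empty set of tessellations is a cover, so T(G) = 0, while χ(K(G)) = ω(K(G)) = 1. *)

theory Defs
  imports Main "HOL-Library.Ramsey" "HOL-Library.Disjoint_Sets"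
begin

type_synonym 'a ugraph = "'a set \<times> 'a set set"

abbreviation uverts :: "'a ugraph \<Rightarrow> 'a set" where "uverts G \<equiv> fst G"
abbreviation uedges :: "'a ugraph \<Rightarrow> 'a set set" where "uedges G \<equiv> snd G"

text \<open>Finite simple undirected graphs; edges are two-element sets of vertices.\<close>

definition ugraph :: "'a ugraph \<Rightarrow> bool" where
  "ugraph G \<longleftrightarrow> finite (uverts G) \<and> uedges G \<subseteq> [uverts G]\<^bsup>2\<^esup>"

definition induced_ugraph :: "'a ugraph \<Rightarrow> 'a set \<Rightarrow> 'a ugraph" where
  "induced_ugraph G S = (S, {e \<in> uedges G. e \<subseteq> S})"

definition ugraph_iso :: "'a ugraph \<Rightarrow> 'b ugraph \<Rightarrow> bool" where
  "ugraph_iso G H \<longleftrightarrow> (\<exists>f. bij_betw f (uverts G) (uverts H) \<and>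
     (\<forall>u\<in>uverts G. \<forall>v\<in>uverts G. {u, v} \<in> uedges G \<longleftrightarrow> {f u, f v} \<in> uedges H))"

definition diamond :: "nat ugraph" where
  "diamond = ({..<4}, [{..<4}]\<^bsup>2\<^esup> - {{2, 3}})"

definition diamond_free :: "'a ugraph \<Rightarrow> bool" where
  "diamond_free G \<longleftrightarrow> \<not> (\<exists>S \<subseteq> uverts G. ugraph_iso (induced_ugraph G S) diamond)"

text \<open>
  The library predicate \<^const>\<open>clique\<close> says that distinct elements of a set are adjacent;
  it does not require them to be vertices of the graph.
\<close>

definition cliques :: "'a ugraph \<Rightarrow> 'a set set" where
  "cliques G = {C. C \<subseteq> uverts G \<and> clique C (uedges G)}"

definition maximal_cliques :: "'a ugraph \<Rightarrow> 'a set set" where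
  "maximal_cliques G = {C \<in> cliques G. \<forall>D \<in> cliques G. C \<subseteq> D \<longrightarrow> C = D}"

definition clique_graph :: "'a ugraph \<Rightarrow> 'a set ugraph" where
  "clique_graph G = (maximal_cliques G,
     {{C, D} | C D. C \<in> maximal_cliques G \<and> D \<in> maximal_cliques G \<and> C \<noteq> D \<and> C \<inter> D \<noteq> {}})"

definition clique_number :: "'a ugraph \<Rightarrow> nat" where
  "clique_number G = Max (card ` cliques G)"

definition proper_colouring :: "'a ugraph \<Rightarrow> nat \<Rightarrow> ('a \<Rightarrow> nat) \<Rightarrow> bool" where
  "proper_colouring G k c \<longleftrightarrow> (\<forall>v \<in> uverts G. c v < k) \<and>
     (\<forall>u v. {u, v} \<in> uedges G \<longrightarrow> c u \<noteq> c v)"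

definition chromatic_number :: "'a ugraph \<Rightarrow> nat" where
  "chromatic_number G = (LEAST k. \<exists>c. proper_colouring G k c)"

definition tessellation :: "'a ugraph \<Rightarrow> 'a set set \<Rightarrow> bool" where
  "tessellation G P \<longleftrightarrow> partition_on (uverts G) P \<and> P \<subseteq> cliques G"

definition tessellation_edges :: "'a ugraph \<Rightarrow> 'a set set \<Rightarrow> 'a set set" where
  "tessellation_edges G P = {e \<in> uedges G. \<exists>C \<in> P. e \<subseteq> C}"

definition tessellation_cover :: "'a ugraph \<Rightarrow> 'a set set set \<Rightarrow> bool" where
  "tessellation_cover G T \<longleftrightarrow> (\<forall>P \<in> T. tessellation G P) \<and>
     (\<forall>e \<in> uedges G. \<exists>P \<in> T. e \<in> tessellation_edges G P)"

definition tessellation_cover_number :: "'a ugraph \<Rightarrow> nat" where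
  "tessellation_cover_number G =
     (LEAST k. \<exists>T. tessellation_cover G T \<and> finite T \<and> card T = k)"

text \<open>
  A graph without edges is covered by the empty set of tessellations, while its clique graph
  needs a colour (and, if there are no vertices, the empty set is the only maximal clique).
  So equality of tessellation cover number and chromatic number of the clique graph can only be
  claimed for graphs that have an edge.
\<close>

lemma edgeless_counterexample:
  assumes "ugraph G" and "uedges G = {}"
  shows "tessellation_cover_number G = 0"
    and "chromatic_number (clique_graph G) = 1"
    and "clique_number (clique_graph G) = 1"
proof -
  have "tessellation_cover G {}"
    using assms(2) by (simp add: tessellation_cover_def)
  then show "tessellation_cover_number G = 0"
    unfolding tessellation_cover_number_def
    by (intro Least_eq_0) (metis card.empty finite.emptyI)
  have sing: "u = v" if "C \<in> cliques G" "u \<in> C" "v \<in> C" for C u v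
    using that assms(2) by (auto simp: cliques_def clique_def)
  have "\<exists>C. C \<in> maximal_cliques G"
  proof (cases "uverts G = {}")
    case True
    then have "{} \<in> maximal_cliques G"
      by (auto simp: maximal_cliques_def cliques_def clique_def)
    then show ?thesis by blast
  next
    case False
    then obtain v where "v \<in> uverts G" by blast
    then have "{v} \<in> cliques G" by (simp add: cliques_def clique_def)
    then have "{v} \<in> maximal_cliques G"
      using sing by (auto simp: maximal_cliques_def)
    then show ?thesis by blast
  qed
  then obtain C where C: "C \<in> maximal_cliques G" by blast
  have "C = D" if "C \<in> maximal_cliques G" "D \<in> maximal_cliques G" "x \<in> C" "x \<in> D" for C D x
  proof -
    have "C \<in> cliques G" "D \<in> cliques G"
      using that by (simp_all add: maximal_cliques_def)
    then have "y \<in> C \<longleftrightarrow> y = x" "y \<in> D \<longleftrightarrow> y = x" for y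
      using sing that(3,4) by metis+
    then show ?thesis by (simp add: set_eq_iff)
  qed
  then have "\<not> (C \<in> maximal_cliques G \<and> D \<in> maximal_cliques G \<and> C \<noteq> D \<and> C \<inter> D \<noteq> {})" for C D
    by blast
  then have noedge: "uedges (clique_graph G) = {}"
    by (simp add: clique_graph_def)
  have "proper_colouring (clique_graph G) 1 (\<lambda>_. 0)"
    by (simp add: proper_colouring_def noedge)
  moreover have "1 \<le> k" if "proper_colouring (clique_graph G) k c" for k c
  proof -
    have "c C < k"
      using that C by (simp add: proper_colouring_def clique_graph_def)
    then show ?thesis by simp
  qed
  ultimately show "chromatic_number (clique_graph G) = 1"
    unfolding chromatic_number_def by (intro Least_equality) blast+
  have "cliques (clique_graph G) = insert {} ((\<lambda>C. {C}) ` maximal_cliques G)" (is "?L = ?R")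
  proof
    show "?L \<subseteq> ?R"
    proof
      fix X assume X: "X \<in> ?L"
      then have sub: "X \<subseteq> maximal_cliques G"
        by (simp add: cliques_def clique_graph_def)
      have eq: "A = B" if "A \<in> X" "B \<in> X" for A B
        using X that by (auto simp: cliques_def clique_def noedge)
      show "X \<in> ?R"
      proof (cases "X = {}")
        case False
        then obtain A where "A \<in> X" by blast
        with eq have "X = {A}" by blast
        with sub show ?thesis by blast
      qed simp
    qed
    show "?R \<subseteq> ?L"
      by (auto simp: cliques_def clique_def clique_graph_def)
  qed
  then have "card ` cliques (clique_graph G) = insert 0 ((\<lambda>_. 1) ` maximal_cliques G)"
    by (simp add: image_image)
  then have "card ` cliques (clique_graph G) = {0, 1}"
    using C by auto
  then show "clique_number (clique_graph G) = 1"
    by (simp add: clique_number_def)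
qed

end

theory Submission
  imports Defs
begin

text \<open>
  Colour classes of the clique graph consist of pairwise disjoint maximal cliques, so adding
  singletons turns each of them into a tessellation; hence \<open>T(G) \<le> \<chi>(K(G))\<close> for every \<open>G\<close>.
  In a diamond-free graph distinct maximal cliques share at most one vertex. This implies a Helly
  property: a clique of the clique graph with at least two elements is a family of maximal cliques
  through a common vertex \<open>v\<close>. A tile containing \<open>v\<close> meets at most one of these cliques outside
  \<open>v\<close>, so each of them needs its own tessellation, and \<open>\<omega>(K(G)) \<le> T(G)\<close>.
\<close>

section \<open>Finiteness and extension of cliques\<close>

lemma finite_cliques: "ugraph G \<Longrightarrow> finite (cliques G)"
  by (rule finite_subset[of _ "Pow (uverts G)"]) (auto simp: ugraph_def cliques_def)

lemma finite_maximal_cliques: "ugraph G \<Longrightarrow> finite (maximal_cliques G)"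
  by (rule finite_subset[OF _ finite_cliques]) (auto simp: maximal_cliques_def)

lemma edge_eq_doubletonE:
  assumes "ugraph G" "e \<in> uedges G"
  obtains u v where "e = {u, v}" "u \<noteq> v" "u \<in> uverts G" "v \<in> uverts G"
proof -
  have "e \<subseteq> uverts G" "card e = 2"
    using assms by (auto simp: ugraph_def nsets_def)
  then show ?thesis
    using that by (auto simp: card_2_iff)
qed

lemma edge_in_cliques: "ugraph G \<Longrightarrow> e \<in> uedges G \<Longrightarrow> e \<in> cliques G"
  by (erule edge_eq_doubletonE) (auto simp: cliques_def clique_def insert_commute)

lemma clique_subset_maximal_clique:
  assumes "ugraph G" "C \<in> cliques G"
  obtains M where "M \<in> maximal_cliques G" "C \<subseteq> M"
  using finite_has_maximal2[OF finite_cliques[OF assms(1)] assms(2)]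
  by (auto simp: maximal_cliques_def)

lemma maximal_clique_adjacent:
  "C \<in> maximal_cliques G \<Longrightarrow> a \<in> C \<Longrightarrow> b \<in> C \<Longrightarrow> a \<noteq> b \<Longrightarrow> {a, b} \<in> uedges G"
  by (auto simp: maximal_cliques_def cliques_def clique_def)

section \<open>Maximal cliques of diamond-free graphs\<close>

lemma induced_diamond:
  assumes "a \<in> uverts G" "b \<in> uverts G" "x \<in> uverts G" "y \<in> uverts G"
    and "distinct [a, b, x, y]" and "ugraph G"
    and "{a, b} \<in> uedges G" "{a, x} \<in> uedges G" "{a, y} \<in> uedges G"
      "{b, x} \<in> uedges G" "{b, y} \<in> uedges G" "{x, y} \<notin> uedges G"
  shows "\<not> diamond_free G"
proof -
  \<comment> \<open>The non-adjacent pair \<open>x\<close>, \<open>y\<close> goes to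
    \<open>2\<close>, \<open>3\<close>, the missing edge of \<open>diamond\<close>; \<open>y\<close>
    gets its value from the default \<open>3\<close>.\<close>
  define f :: "_ \<Rightarrow> nat" where "f = (\<lambda>_. 3)(a := 0, b := 1, x := 2)"
  have f: "f a = 0" "f b = 1" "f x = 2" "f y = 3"
    using assms(5) by (auto simp: f_def)
  have lt4: "{..<4} = {0, 1, 2, 3 :: nat}" by auto
  \<comment> \<open>\<open>ugraph_iso\<close> also quantifies over equal vertices, where
    \<open>{u, u}\<close> collapses to a singleton.\<close>
  have no_loop: "{u} \<notin> uedges G" for u
    using \<open>ugraph G\<close> by (auto simp: ugraph_def nsets_def)
  have diamond_edge: "{i, j} \<in> uedges diamond \<longleftrightarrow>
      i < 4 \<and> j < 4 \<and> i \<noteq> j \<and> {i, j} \<noteq> {2, 3}" for i j :: nat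
    by (auto simp: diamond_def nsets_def card_insert_if)
  have "bij_betw f {a, b, x, y} {..<4}"
    unfolding bij_betw_def lt4 using f by (auto simp: inj_on_def)
  moreover have "\<forall>u\<in>{a, b, x, y}. \<forall>v\<in>{a, b, x, y}.
      {u, v} \<in> uedges (induced_ugraph G {a, b, x, y}) \<longleftrightarrow> {f u, f v} \<in> uedges diamond"
    unfolding diamond_edge induced_ugraph_def
    using assms(7-12) f no_loop by (simp add: insert_commute doubleton_eq_iff)
  ultimately have "ugraph_iso (induced_ugraph G {a, b, x, y}) diamond"
    unfolding ugraph_iso_def
    by (intro exI[of _ f]) (simp add: induced_ugraph_def diamond_def)
  then show ?thesis
    unfolding diamond_free_def using assms(1-4)
    by (intro notI) (meson empty_subsetI insert_subset)
qed

text \<open>If \<open>x\<close> lies in \<open>C\<close> but not in \<open>D\<close>, maximality of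
  \<open>D\<close> yields some \<open>y\<close> in \<open>D\<close> not adjacent to
  \<open>x\<close>. Both are adjacent to \<open>a\<close> and \<open>b\<close>, so the four vertices
  induce a diamond.\<close>

lemma maximal_cliques_eqI:
  assumes G: "ugraph G" "diamond_free G"
    and C: "C \<in> maximal_cliques G" and D: "D \<in> maximal_cliques G"
    and ab: "a \<noteq> b" "a \<in> C" "b \<in> C" "a \<in> D" "b \<in> D"
  shows "C = D"
proof (rule ccontr)
  assume "C \<noteq> D"
  then obtain x where x: "x \<in> C" "x \<notin> D"
    using C D by (auto simp: maximal_cliques_def)
  have sub: "C \<subseteq> uverts G" "D \<subseteq> uverts G"
    using C D by (auto simp: maximal_cliques_def cliques_def)
  have "insert x D \<notin> cliques G"
    using D x by (auto simp: maximal_cliques_def)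
  then obtain y where y: "y \<in> D" "{x, y} \<notin> uedges G"
    using D x sub by (auto simp: maximal_cliques_def cliques_def clique_def insert_commute)
  \<comment> \<open>Inside \<open>C\<close>, \<open>x\<close> is adjacent to \<open>a\<close> and
    \<open>b\<close>, but it is not adjacent to \<open>y\<close>.\<close>
  have "a \<noteq> y" "b \<noteq> y"
    using y x ab maximal_clique_adjacent[OF C] by metis+
  then have "\<not> diamond_free G"
    using G x y ab sub maximal_clique_adjacent[OF C] maximal_clique_adjacent[OF D]
    by (intro induced_diamond[of a G b x y]) auto
  with G show False by simp
qed

text \<open>If \<open>E\<close> missed \<open>v\<close>, it would meet \<open>C\<close> and
  \<open>D\<close> in vertices \<open>b\<close> and \<open>c\<close> forming a triangle with
  \<open>v\<close>. A maximal clique containing this triangle shares two vertices with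
  \<open>C\<close> and two with \<open>D\<close>, hence equals both.\<close>

lemma maximal_cliques_Helly:
  assumes G: "ugraph G" "diamond_free G"
    and M: "C \<in> maximal_cliques G" "D \<in> maximal_cliques G" "E \<in> maximal_cliques G"
    and CD: "C \<noteq> D" "v \<in> C" "v \<in> D" and E: "E \<inter> C \<noteq> {}" "E \<inter> D \<noteq> {}"
  shows "v \<in> E"
proof (rule ccontr)
  assume v: "v \<notin> E"
  obtain b c where b: "b \<in> E" "b \<in> C" and c: "c \<in> E" "c \<in> D"
    using E by blast
  have ne: "b \<noteq> v" "c \<noteq> v"
    using v b c by auto
  \<comment> \<open>Otherwise \<open>C\<close> and \<open>D\<close> would share both
    \<open>v\<close> and \<open>b\<close>.\<close>
  moreover have "b \<noteq> c"
    using maximal_cliques_eqI[OF G M(1,2), of v b] b c CD ne(1) by auto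
  moreover have "{v, b} \<in> uedges G" "{v, c} \<in> uedges G" "{b, c} \<in> uedges G"
    using maximal_clique_adjacent[OF M(1), of v b] maximal_clique_adjacent[OF M(2), of v c]
      maximal_clique_adjacent[OF M(3), of b c] \<open>b \<noteq> c\<close> b c CD ne by auto
  moreover have "{v, b, c} \<subseteq> uverts G"
    using b c CD M by (auto simp: maximal_cliques_def cliques_def)
  ultimately have "{v, b, c} \<in> cliques G"
    by (simp add: cliques_def clique_def insert_commute)
  then obtain K where "K \<in> maximal_cliques G" "{v, b, c} \<subseteq> K"
    using clique_subset_maximal_clique[OF G(1)] by blast
  then have "K = C" "K = D"
    using maximal_cliques_eqI[OF G _ M(1), of K v b] maximal_cliques_eqI[OF G _ M(2), of K v c]
      b c CD ne by auto
  with CD show False by simp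
qed

section \<open>Lower bound by the clique number of the clique graph\<close>

text \<open>Pick in each \<open>C\<close> an edge from \<open>v\<close> to some \<open>u C\<close>
  and a tessellation \<open>P C\<close> covering it. The choice \<open>P\<close> is injective, which
  bounds \<open>card X\<close>.\<close>

lemma card_maximal_cliques_at_vertex_le:
  assumes G: "ugraph G" "diamond_free G"
    and X: "X \<subseteq> maximal_cliques G" "\<And>C. C \<in> X \<Longrightarrow> v \<in> C" "2 \<le> card X"
    and T: "tessellation_cover G T" "finite T"
  shows "card X \<le> card T"
proof -
  \<comment> \<open>By maximality \<open>C\<close> has a vertex outside another member
    \<open>D\<close> of \<open>X\<close>; this vertex differs from \<open>v\<close> because
    \<open>v\<close> lies in \<open>D\<close>.\<close>
  have "\<exists>u. u \<in> C \<and> u \<noteq> v" if C: "C \<in> X" for C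
  proof -
    have "X \<noteq> {C}" using X(3) by auto
    then obtain D where "D \<in> X" "D \<noteq> C" using C by blast
    then have "\<not> C \<subseteq> D"
      using C X(1) by (auto simp: maximal_cliques_def)
    then show ?thesis
      using X(2)[OF \<open>D \<in> X\<close>] by blast
  qed
  then obtain u where u: "\<And>C. C \<in> X \<Longrightarrow> u C \<in> C \<and> u C \<noteq> v" by metis
  have "\<exists>P\<in>T. \<exists>K\<in>P. {v, u C} \<subseteq> K" if "C \<in> X" for C
  proof -
    have "{v, u C} \<in> uedges G"
      using that u X maximal_clique_adjacent[of C G v "u C"] by (metis subsetD)
    then obtain P where "P \<in> T" "{v, u C} \<in> tessellation_edges G P"
      using T unfolding tessellation_cover_def by blast
    then show ?thesis
      unfolding tessellation_edges_def by blast
  qed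
  then obtain P where P: "\<And>C. C \<in> X \<Longrightarrow> P C \<in> T \<and> (\<exists>K\<in>P C. {v, u C} \<subseteq> K)" by metis
  have "inj_on P X"
  proof (rule inj_onI)
    fix C D assume CD: "C \<in> X" "D \<in> X" "P C = P D"
    obtain K L where K: "K \<in> P C" "{v, u C} \<subseteq> K" and L: "L \<in> P C" "{v, u D} \<subseteq> L"
      using P CD by metis
    have tess: "tessellation G (P C)"
      using P[OF CD(1)] T by (simp add: tessellation_cover_def)
    \<comment> \<open>Both tiles contain \<open>v\<close>, and tiles of one tessellation are
      disjoint.\<close>
    then have "K = L"
      using K L by (auto simp: tessellation_def partition_on_def disjoint_def)
    moreover from tess obtain M where M: "M \<in> maximal_cliques G" "K \<subseteq> M"
      using K clique_subset_maximal_clique[OF G(1)]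
      by (metis tessellation_def subsetD)
    ultimately have "v \<in> M" "u C \<in> M" "u D \<in> M"
      using K L by auto
    then have "M = C" "M = D"
      using maximal_cliques_eqI[OF G M(1), of C v "u C"]
        maximal_cliques_eqI[OF G M(1), of D v "u D"] CD(1,2) X(1,2) u by blast+
    then show "C = D" by simp
  qed
  then show ?thesis
    using P T(2) by (intro card_inj_on_le[of P]) auto
qed

lemma clique_number_le_tessellation_cover:
  assumes G: "ugraph G" "uedges G \<noteq> {}" "diamond_free G"
    and T: "tessellation_cover G T" "finite T"
  shows "clique_number (clique_graph G) \<le> card T"
proof -
  let ?K = "clique_graph G"
  have card_X: "card X \<le> card T" if "X \<in> cliques ?K" for X
  proof (cases "2 \<le> card X")
    \<comment> \<open>With at most one member in \<open>X\<close> there need be no common edge to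
      exploit; an edge of \<open>G\<close> forces at least one tessellation.\<close>
    case False
    have "T \<noteq> {}" using G(2) T(1) by (auto simp: tessellation_cover_def)
    then have "1 \<le> card T" using T(2) by (simp add: Suc_le_eq card_gt_0_iff)
    with False show ?thesis by linarith
  next
    case True
    have sub: "X \<subseteq> maximal_cliques G"
      using that by (simp add: cliques_def clique_graph_def)
    have meet: "A \<inter> B \<noteq> {}" if "A \<in> X" "B \<in> X" "A \<noteq> B" for A B
      using that \<open>X \<in> cliques ?K\<close>
      by (auto simp: cliques_def clique_def clique_graph_def doubleton_eq_iff)
    obtain C D where CD: "C \<in> X" "D \<in> X" "C \<noteq> D"
      using True by (metis card_2_iff' obtain_subset_with_card_n subsetD)
    then obtain v where v: "v \<in> C" "v \<in> D" using meet by blast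
    have "v \<in> E" if "E \<in> X" for E
    proof (cases "E = C \<or> E = D")
      case False
      then show ?thesis
        using maximal_cliques_Helly[OF G(1,3), of C D E v] CD v that sub meet by blast
    qed (use v in auto)
    then show ?thesis
      using card_maximal_cliques_at_vertex_le[OF G(1,3) sub _ True T] by blast
  qed
  have "finite (cliques ?K)"
    by (rule finite_subset[of _ "Pow (maximal_cliques G)"])
       (auto simp: cliques_def clique_graph_def finite_maximal_cliques[OF G(1)])
  \<comment> \<open>\<open>Max\<close> is only meaningful on a nonempty set.\<close>
  moreover have "{} \<in> cliques ?K"
    by (simp add: cliques_def clique_def)
  ultimately show ?thesis
    unfolding clique_number_def using card_X by (subst Max_le_iff) auto
qed

section \<open>Upper bound by a colouring of the clique graph\<close>

text \<open>Each edge lies in some maximal clique \<open>M\<close>, which is a tile of the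
  tessellation belonging to the colour of \<open>M\<close>.\<close>

lemma tessellation_cover_of_colouring:
  assumes G: "ugraph G" and c: "proper_colouring (clique_graph G) k c"
  obtains T where "tessellation_cover G T" "finite T" "card T \<le> k"
proof -
  \<comment> \<open>The empty clique is excluded because a partition has no empty part; it is a
    maximal clique when \<open>G\<close> has no vertices.\<close>
  define Q where "Q i = {C \<in> maximal_cliques G. c C = i \<and> C \<noteq> {}}" for i
  define P where "P i = Q i \<union> (\<lambda>v. {v}) ` (uverts G - \<Union>(Q i))" for i
  have Q_sub: "C \<subseteq> uverts G" "C \<in> cliques G" if "C \<in> Q i" for C i
    using that by (auto simp: Q_def maximal_cliques_def cliques_def)
  have Q_disj: "C \<inter> D = {}" if "C \<in> Q i" "D \<in> Q i" "C \<noteq> D" for C D i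
  proof (rule ccontr)
    assume "C \<inter> D \<noteq> {}"
    then have "{C, D} \<in> uedges (clique_graph G)"
      using that by (auto simp: clique_graph_def Q_def)
    then have "c C \<noteq> c D"
      using c unfolding proper_colouring_def by blast
    then show False
      using that by (simp add: Q_def)
  qed
  have tess: "tessellation G (P i)" for i
    unfolding tessellation_def
  proof
    show "partition_on (uverts G) (P i)"
    proof (rule partition_onI)
      show "\<Union>(P i) = uverts G"
        using Q_sub by (auto simp: P_def)
      show "\<And>p q. p \<in> P i \<Longrightarrow> q \<in> P i \<Longrightarrow> p \<noteq> q \<Longrightarrow> disjnt p q"
        using Q_disj by (auto simp: P_def disjnt_def)
      show "{} \<notin> P i"
        by (auto simp: P_def Q_def)
    qed
    show "P i \<subseteq> cliques G"
      using Q_sub by (auto simp: P_def cliques_def clique_def)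
  qed
  have cover: "\<exists>i<k. e \<in> tessellation_edges G (P i)" if e: "e \<in> uedges G" for e
  proof -
    obtain M where M: "M \<in> maximal_cliques G" "e \<subseteq> M"
      using clique_subset_maximal_clique[OF G edge_in_cliques[OF G e]] by metis
    moreover have "e \<noteq> {}"
      using edge_eq_doubletonE[OF G e] by blast
    ultimately have "M \<in> P (c M)" by (auto simp: P_def Q_def)
    moreover have "c M < k"
      using c M by (simp add: proper_colouring_def clique_graph_def)
    ultimately show ?thesis
      using e M by (auto simp: tessellation_edges_def)
  qed
  have "tessellation_cover G (P ` {..<k})"
    unfolding tessellation_cover_def using tess cover by blast
  \<comment> \<open>Only an inequality: different colours may give the same tessellation.\<close>
  moreover have "card (P ` {..<k}) \<le> k"
    using card_image_le[of "{..<k}" P] by simp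
  ultimately show ?thesis
    using that by blast
qed

text \<open>An injective colouring is proper. This makes the \<open>LEAST\<close> in
  \<open>chromatic_number\<close> an attained value.\<close>

lemma ex_proper_colouring:
  assumes "finite (uverts H)" "\<And>u v. {u, v} \<in> uedges H \<Longrightarrow> u \<in> uverts H \<and> v \<in> uverts H \<and> u \<noteq> v"
  shows "\<exists>k c. proper_colouring H k c"
proof -
  obtain c where c: "bij_betw c (uverts H) {0..<card (uverts H)}"
    using ex_bij_betw_finite_nat[OF assms(1)] by blast
  then have "proper_colouring H (card (uverts H)) c"
    using assms(2) by (auto simp: proper_colouring_def bij_betw_def inj_on_def)
  then show ?thesis by blast
qed

theorem theorem2:
  fixes G :: "'a ugraph"
  assumes "ugraph G"
    and "uedges G \<noteq> {}"
    and "diamond_free G"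
    and "chromatic_number (clique_graph G) = clique_number (clique_graph G)"
  shows "tessellation_cover_number G = chromatic_number (clique_graph G)"
proof (rule antisym)
  let ?K = "clique_graph G" and ?cover = "\<lambda>k T. tessellation_cover G T \<and> finite T \<and> card T = k"
  have "\<exists>k c. proper_colouring ?K k c"
    by (rule ex_proper_colouring)
       (auto simp: clique_graph_def doubleton_eq_iff finite_maximal_cliques[OF assms(1)])
  then have "\<exists>c. proper_colouring ?K (chromatic_number ?K) c"
    unfolding chromatic_number_def by (rule LeastI_ex)
  then obtain T where T: "tessellation_cover G T" "finite T" "card T \<le> chromatic_number ?K"
    using tessellation_cover_of_colouring[OF assms(1)] by metis
  have "tessellation_cover_number G \<le> card T"
    unfolding tessellation_cover_number_def by (rule Least_le) (use T in blast)
  then show "tessellation_cover_number G \<le> chromatic_number ?K"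
    using T(3) by simp
  \<comment> \<open>The cover \<open>T\<close> found above witnesses that the minimum is attained,
    so the lower bound applies to a minimum cover.\<close>
  have "\<exists>T. ?cover (tessellation_cover_number G) T"
    unfolding tessellation_cover_number_def
    by (rule LeastI_ex) (use T in blast)
  then show "chromatic_number ?K \<le> tessellation_cover_number G"
    using clique_number_le_tessellation_cover[OF assms(1-3)] assms(4) by metis
qed

end
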